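(* Let $X\subseteq \mathbb{R}^n$ be a convex set that is either open in $\mathbb{R}^n$ or a polyhedron. Then every real-valued quasi-concave (or quasi-convex) function $f:X\to\mathbb{R}$ is linearly continuous if and only if it is (jointly) continuous.
   Context: A polyhedron is a subset of $\mathbb{R}^n$ that is an intersection of a finite number of closed half-spaces. A straight line in $X$ is the intersection with $X$ of a one-dimensional affine subspace contained in the affine hull of $X$. A function $f:X\to\mathbb{R}$ is linearly continuous if its restriction to every straight line in $X$ is continuous; it is jointly continuous if it is continuous on $X$ in the usual sense. $f$ is quasi-concave if $\{x\in X: f(x)\ge\alpha\}$ is convex for every $\alpha\in\mathbb{R}$, and quasi-convex if $-f$ is quasi-concave. *)

theory Defs
  imports "HOL-Analysis.Analysis"
begin

(* A function on X is represented by a total function whose values outside X are ignored. *)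

definition straight_line_in :: "'a::euclidean_space set \<Rightarrow> 'a set \<Rightarrow> bool" where
  "straight_line_in S X \<longleftrightarrow>
     (\<exists>L. affine L \<and> aff_dim L = 1 \<and> L \<subseteq> affine hull X \<and> S = X \<inter> L)"

definition linearly_continuous_on :: "'a::euclidean_space set \<Rightarrow> ('a \<Rightarrow> real) \<Rightarrow> bool" where
  "linearly_continuous_on X f \<longleftrightarrow> (\<forall>S. straight_line_in S X \<longrightarrow> continuous_on S f)"

definition quasi_concave_on :: "'a::real_vector set \<Rightarrow> ('a \<Rightarrow> real) \<Rightarrow> bool" where
  "quasi_concave_on X f \<longleftrightarrow> (\<forall>\<alpha>. convex {x \<in> X. f x \<ge> \<alpha>})"

definition quasi_convex_on :: "'a::real_vector set \<Rightarrow> ('a \<Rightarrow> real) \<Rightarrow> bool" where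
  "quasi_convex_on X f \<longleftrightarrow> quasi_concave_on X (\<lambda>x. - f x)"

end

(* For quasi-concave f, both semicontinuities at a point x follow from continuity on lines through x.
   Upper: if x lay in the closure of the convex set C = {f >= a} but not in C, the segment from a
   relative interior point of C to x would lie in C except for x, and continuity along it would
   give f x >= a.
   Lower: near x, the set X coincides with a cone over a polytope with apex x; shrinking
   the polytope towards x, its finitely many vertices move along lines through x, so f is nearly f x
   there, and by quasi-concavity on the whole shrunken polytope. *)
theory Submission
  imports Defs
begin

lemma linearly_continuous_on_segment:
  assumes "linearly_continuous_on X f" "convex X" "x \<in> X" "v \<in> X"
  shows "continuous_on {0..1} (\<lambda>t::real. f (x + t *\<^sub>R (v - x)))"
proof (cases "x = v")
  case False
  define L where "L = affine hull {x, v}"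
  have "straight_line_in (X \<inter> L) X"
    unfolding straight_line_in_def
  proof (intro exI conjI)
    show "affine L" "aff_dim L = 1"
      using False by (auto simp: L_def aff_dim_affine_hull aff_dim_2)
    show "L \<subseteq> affine hull X"
      unfolding L_def using assms by (intro hull_mono) auto
  qed simp
  then have cont: "continuous_on (X \<inter> L) f"
    using assms(1) by (auto simp: linearly_continuous_on_def)
  have sub: "(\<lambda>t. x + t *\<^sub>R (v - x)) ` {0..1} \<subseteq> X \<inter> L"
  proof (intro image_subsetI IntI)
    fix t :: real
    assume t: "t \<in> {0..1}"
    have eq: "x + t *\<^sub>R (v - x) = (1 - t) *\<^sub>R x + t *\<^sub>R v"
      by (simp add: algebra_simps)
    show "x + t *\<^sub>R (v - x) \<in> X"
      unfolding eq using assms t by (intro convexD) auto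
    show "x + t *\<^sub>R (v - x) \<in> L"
      unfolding eq L_def affine_hull_2 by (intro CollectI exI[of _ "1 - t"] exI[of _ t]) simp
  qed
  show ?thesis
    by (rule continuous_on_compose2[OF cont _ sub]) (intro continuous_intros)
qed simp

text \<open>Both semicontinuity proofs use linear continuity only in this one-sided form, along the
  segment from \<open>x\<close> to a point \<open>v\<close> of \<open>X\<close>.\<close>

lemma linearly_continuous_on_tendsto_segment:
  assumes "linearly_continuous_on X f" "convex X" "x \<in> X" "v \<in> X"
  shows "((\<lambda>t::real. f (x + t *\<^sub>R (v - x))) \<longlongrightarrow> f x) (at_right 0)"
proof -
  have "((\<lambda>t::real. f (x + t *\<^sub>R (v - x))) \<longlongrightarrow> f (x + 0 *\<^sub>R (v - x))) (at 0 within {0..1})"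
    using linearly_continuous_on_segment[OF assms] unfolding continuous_on_def by (rule bspec) simp
  then show ?thesis
    by (simp add: at_within_Icc_at_right)
qed

lemma quasi_concave_upper_semicontinuous:
  assumes lin: "linearly_continuous_on X f" and X: "convex X" and qc: "quasi_concave_on X f"
    and x: "x \<in> X" and less: "f x < \<alpha>"
  shows "\<forall>\<^sub>F y in at x within X. f y < \<alpha>"
proof -
  define C where "C = {y \<in> X. f y \<ge> \<alpha>}"
  have C: "convex C" "x \<notin> C"
    using qc less by (auto simp: quasi_concave_on_def C_def)
  \<comment> \<open>This suffices: the complement of \<open>closure C\<close> is then an open
    neighbourhood of \<open>x\<close>, and at its points in \<open>X\<close> the value of
    \<open>f\<close> is below \<alpha>.\<close>
  have "x \<notin> closure C"
  proof
    assume clos: "x \<in> closure C"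
    then have "C \<noteq> {}" by auto
    then obtain c where c: "c \<in> rel_interior C"
      using C rel_interior_eq_empty by blast
    then have "c \<in> C" using rel_interior_subset by blast
    then have "c \<in> X" "x \<noteq> c" using C by (auto simp: C_def)
    have "\<forall>\<^sub>F t::real in at_right 0. \<alpha> \<le> f (x + t *\<^sub>R (c - x))"
      using eventually_at_right_real[OF zero_less_one]
    proof eventually_elim
      case (elim t)
      \<comment> \<open>The form in which the library moves a point of the closure towards a
        relative interior point.\<close>
      have "x + t *\<^sub>R (c - x) = x - t *\<^sub>R (x - c)"
        by (simp add: algebra_simps)
      also have "\<dots> \<in> rel_interior C"
        using elim by (intro rel_interior_closure_convex_shrink C c clos) auto
      finally show ?case
        using rel_interior_subset by (auto simp: C_def)
    qed
    then have "\<alpha> \<le> f x"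
      using linearly_continuous_on_tendsto_segment[OF lin X x \<open>c \<in> X\<close>]
      by (intro tendsto_lowerbound) auto
    with less show False by simp
  qed
  then have "\<forall>\<^sub>F y in nhds x. y \<in> - closure C"
    by (intro eventually_nhds_in_open) auto
  then have "\<forall>\<^sub>F y in nhds x. y \<in> X \<longrightarrow> f y < \<alpha>"
    by eventually_elim (use closure_subset[of C] in \<open>auto simp: C_def not_le\<close>)
  then show ?thesis
    unfolding eventually_at_filter by eventually_elim simp
qed

text \<open>The hypothesis \<open>conic\<close> says that, however small a copy of \<open>P\<close>
  is taken by scaling about \<open>x\<close>, it still contains all points of \<open>X\<close> close
  to \<open>x\<close>. It is the only information on the shape of \<open>X\<close> that the vertex
  argument takes besides convexity.\<close>

lemma quasi_concave_lower_semicontinuous: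
  assumes lin: "linearly_continuous_on X f" and X: "convex X" and qc: "quasi_concave_on X f"
    and x: "x \<in> X" and less: "\<alpha> < f x"
    and P: "polytope P" "P \<subseteq> X"
    and conic: "\<And>s::real. s > 0 \<Longrightarrow> \<forall>\<^sub>F y in at x within X. x + s *\<^sub>R (y - x) \<in> P"
  shows "\<forall>\<^sub>F y in at x within X. \<alpha> < f y"
proof -
  obtain V where V: "finite V" "P = convex hull V"
    using P by (auto simp: polytope_def)
  have VX: "V \<subseteq> X" using hull_subset[of V convex] P(2) V(2) by simp
  \<comment> \<open>Quasi-concavity will yield only a weak bound by \<beta> on the shrunken
    polytope; the gap between \<alpha> and \<beta> makes the final bound strict.\<close>
  obtain \<beta> where \<beta>: "\<alpha> < \<beta>" "\<beta> < f x" using dense[OF less] by auto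
  have "\<forall>\<^sub>F t::real in at_right 0. \<forall>v\<in>V. \<beta> < f (x + t *\<^sub>R (v - x))"
  proof (intro eventually_ball_finite ballI)
    fix v assume "v \<in> V"
    with VX have "v \<in> X" by blast
    from linearly_continuous_on_tendsto_segment[OF lin X x this] \<beta>(2)
    show "\<forall>\<^sub>F t::real in at_right 0. \<beta> < f (x + t *\<^sub>R (v - x))"
      by (rule order_tendstoD(1))
  qed (rule V)
  \<comment> \<open>With \<open>t < 1\<close> the shrunken vertices are convex combinations of
    \<open>x\<close> and points of \<open>V\<close>, hence stay in \<open>X\<close>.\<close>
  then have "\<forall>\<^sub>F t::real in at_right 0. t \<in> {0<..<1} \<and> (\<forall>v\<in>V. \<beta> < f (x + t *\<^sub>R (v - x)))"
    using eventually_at_right_real[OF zero_less_one] by eventually_elim auto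
  then have "\<exists>t::real. t \<in> {0<..<1} \<and> (\<forall>v\<in>V. \<beta> < f (x + t *\<^sub>R (v - x)))"
    by (intro eventually_happens'[of "at_right 0"]) auto
  then obtain t :: real where t: "0 < t" "t < 1" "\<forall>v\<in>V. \<beta> < f (x + t *\<^sub>R (v - x))"
    by auto
  define C where "C = {y \<in> X. f y \<ge> \<beta>}"
  have "convex C" using qc by (simp add: C_def quasi_concave_on_def)
  \<comment> \<open>Pulling \<open>C\<close> back along the scaling avoids computing the image of a
    hull: a convex preimage that contains \<open>V\<close> contains \<open>P\<close>.\<close>
  then have conv: "convex ((\<lambda>p. x + t *\<^sub>R (p - x)) -` C)"
    unfolding convex_alt
  proof (clarsimp)
    fix p q and u :: real
    assume pq: "x + t *\<^sub>R (p - x) \<in> C" "x + t *\<^sub>R (q - x) \<in> C" "0 \<le> u" "u \<le> 1"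
    have "x + t *\<^sub>R ((1 - u) *\<^sub>R p + u *\<^sub>R q - x) =
        (1 - u) *\<^sub>R (x + t *\<^sub>R (p - x)) + u *\<^sub>R (x + t *\<^sub>R (q - x))"
      by (simp add: algebra_simps)
    also have "\<dots> \<in> C" using \<open>convex C\<close> pq by (intro convexD) auto
    finally show "x + t *\<^sub>R ((1 - u) *\<^sub>R p + u *\<^sub>R q - x) \<in> C" .
  qed
  have "x + t *\<^sub>R (v - x) \<in> X" if "v \<in> V" for v
  proof -
    have "x + t *\<^sub>R (v - x) = (1 - t) *\<^sub>R x + t *\<^sub>R v"
      by (simp add: algebra_simps)
    also have "\<dots> \<in> X" using X x VX that t by (intro convexD) auto
    finally show ?thesis .
  qed
  then have "V \<subseteq> (\<lambda>p. x + t *\<^sub>R (p - x)) -` C"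
    using t by (auto simp: C_def less_imp_le)
  then have sub: "P \<subseteq> (\<lambda>p. x + t *\<^sub>R (p - x)) -` C"
    using conv unfolding V by (rule hull_minimal)
  \<comment> \<open>The factor \<open>1 / t\<close> undoes the shrinking, so \<open>y\<close> is the
    shrunken image of a point of \<open>P\<close>.\<close>
  have "\<forall>\<^sub>F y in at x within X. x + (1 / t) *\<^sub>R (y - x) \<in> P"
    using t by (intro conic) simp
  then show ?thesis
  proof eventually_elim
    case (elim y)
    then have "y \<in> C" using sub t by fastforce
    then show ?case using \<beta> by (auto simp: C_def)
  qed
qed

lemma filterlim_scale_about:
  "filterlim (\<lambda>y. x + s *\<^sub>R (y - x)) (nhds x) (nhds (x::'a::real_normed_vector))"
proof -
  have "((\<lambda>y. x + s *\<^sub>R (y - x)) \<longlongrightarrow> x + s *\<^sub>R (x - x)) (nhds x)"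
    by (intro tendsto_intros filterlim_ident)
  then show ?thesis by simp
qed

text \<open>A half-space with \<open>x\<close> in its interior contains a neighbourhood of
  \<open>x\<close>, and scaling about \<open>x\<close> is continuous and fixes \<open>x\<close>. A
  half-space with \<open>x\<close> on its boundary is preserved by scaling about \<open>x\<close>
  with a positive factor. There are finitely many half-spaces, so the neighbourhoods can be
  intersected.\<close>

lemma polyhedron_locally_conic:
  assumes "polyhedron X" "x \<in> X" "s > 0"
  shows "\<forall>\<^sub>F y in nhds x. y \<in> X \<longrightarrow> x + s *\<^sub>R (y - x) \<in> X"
proof -
  obtain F where F: "finite F" "X = \<Inter>F" "\<And>h. h \<in> F \<Longrightarrow> \<exists>a b. a \<noteq> 0 \<and> h = {x. a \<bullet> x \<le> b}"
    using assms by (auto simp: polyhedron_def)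
  have "\<forall>\<^sub>F y in nhds x. \<forall>h\<in>F. y \<in> h \<longrightarrow> x + s *\<^sub>R (y - x) \<in> h"
  proof (intro eventually_ball_finite F ballI)
    fix h assume h: "h \<in> F"
    then obtain a b where ab: "h = {x. a \<bullet> x \<le> b}" using F by blast
    have "a \<bullet> x \<le> b" using h ab assms F by auto
    then consider "a \<bullet> x < b" | "a \<bullet> x = b" by linarith
    then show "\<forall>\<^sub>F y in nhds x. y \<in> h \<longrightarrow> x + s *\<^sub>R (y - x) \<in> h"
    proof cases
      case 1
      then have "\<forall>\<^sub>F z in nhds x. z \<in> {z. a \<bullet> z < b}"
        by (intro eventually_nhds_in_open open_halfspace_lt) auto
      then have "\<forall>\<^sub>F y in nhds x. x + s *\<^sub>R (y - x) \<in> {z. a \<bullet> z < b}"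
        by (rule eventually_compose_filterlim[OF _ filterlim_scale_about])
      then show ?thesis by eventually_elim (auto simp: ab)
    next
      case 2
      then have "a \<bullet> (x + s *\<^sub>R (y - x)) \<le> b" if "a \<bullet> y \<le> b" for y
        using that assms(3) by (simp add: inner_simps mult_le_0_iff)
      then show ?thesis by (simp add: ab)
    qed
  qed
  then show ?thesis by eventually_elim (auto simp: F(2))
qed

text \<open>For open \<open>X\<close>, a closed box around \<open>x\<close> inside \<open>X\<close>
  serves as \<open>P\<close>; for a polyhedron, the part of \<open>X\<close> in a box around
  \<open>x\<close>.\<close>

lemma ex_polytope_locally_conic:
  fixes X :: "'a::euclidean_space set"
  assumes "open X \<or> polyhedron X" "x \<in> X"
  obtains P where "polytope P" "P \<subseteq> X"
    "\<And>s::real. s > 0 \<Longrightarrow> \<forall>\<^sub>F y in at x within X. x + s *\<^sub>R (y - x) \<in> P"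
proof -
  have box_ev: "\<forall>\<^sub>F y in nhds x. x + s *\<^sub>R (y - x) \<in> box a b" if "x \<in> box a b" for a b and s :: real
    using that
    by (intro eventually_compose_filterlim[OF _ filterlim_scale_about] eventually_nhds_in_open) auto
  consider "open X" | "polyhedron X" using assms by blast
  then show thesis
  proof cases
    case 1
    then obtain a b where ab: "x \<in> box a b" "cbox a b \<subseteq> X"
      using assms(2) by (metis open_contains_cbox)
    show thesis
    proof (rule that[of "cbox a b"])
      show "\<forall>\<^sub>F y in at x within X. x + s *\<^sub>R (y - x) \<in> cbox a b" for s
        unfolding eventually_at_filter using box_ev[OF ab(1), of s]
        by eventually_elim (use box_subset_cbox[of a b] in auto)
    qed (use ab polytope_interval in auto)
  next
    case 2
    \<comment> \<open>Any box with \<open>x\<close> in its interior will do, since it only has to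
      cut \<open>X\<close> down to a bounded set.\<close>
    obtain a b where ab: "x \<in> box a b"
      by (rule open_contains_cbox[of UNIV x]) auto
    show thesis
    proof (rule that[of "X \<inter> cbox a b"])
      show "polytope (X \<inter> cbox a b)"
        using 2 by (metis Int_commute polytope_Int_polyhedron polytope_interval)
      show "\<forall>\<^sub>F y in at x within X. x + s *\<^sub>R (y - x) \<in> X \<inter> cbox a b" if "s > 0" for s
        unfolding eventually_at_filter
        using polyhedron_locally_conic[OF 2 assms(2) that] box_ev[OF ab, of s]
        by eventually_elim (use box_subset_cbox[of a b] in auto)
    qed simp
  qed
qed

lemma quasi_concave_linearly_continuous_imp_continuous:
  fixes X :: "'a::euclidean_space set"
  assumes "convex X" "open X \<or> polyhedron X" "quasi_concave_on X f" "linearly_continuous_on X f"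
  shows "continuous_on X f"
  unfolding continuous_on_def
proof (intro ballI order_tendstoI)
  fix x \<alpha> assume x: "x \<in> X"
  show "\<forall>\<^sub>F y in at x within X. f y < \<alpha>" if "f x < \<alpha>"
    using assms x that by (intro quasi_concave_upper_semicontinuous)
  show "\<forall>\<^sub>F y in at x within X. \<alpha> < f y" if "\<alpha> < f x"
    by (rule ex_polytope_locally_conic[OF assms(2) x])
      (rule quasi_concave_lower_semicontinuous[OF assms(4,1,3) x that])
qed

theorem theorem1:
  fixes X :: "(real ^ 'n) set" and f :: "real ^ 'n \<Rightarrow> real"
  assumes "convex X"
    and "open X \<or> polyhedron X"
    and "quasi_concave_on X f \<or> quasi_convex_on X f"
  shows "linearly_continuous_on X f \<longleftrightarrow> continuous_on X f"
proof
  assume lin: "linearly_continuous_on X f"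
  show "continuous_on X f"
    using assms(3)
  proof
    assume "quasi_concave_on X f"
    with assms lin show ?thesis
      by (intro quasi_concave_linearly_continuous_imp_continuous)
  next
    assume "quasi_convex_on X f"
    moreover have "linearly_continuous_on X (\<lambda>x. - f x)"
      using lin by (auto simp: linearly_continuous_on_def intro: continuous_on_minus)
    ultimately have "continuous_on X (\<lambda>x. - f x)"
      using assms by (intro quasi_concave_linearly_continuous_imp_continuous)
        (auto simp: quasi_convex_on_def)
    then show ?thesis
      using continuous_on_minus by fastforce
  qed
next
  assume "continuous_on X f"
  then show "linearly_continuous_on X f"
    by (auto simp: linearly_continuous_on_def straight_line_in_def intro: continuous_on_subset)
qed

end
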